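(* For any smooth oblivious power assignment $p$ and every $n$, there is a set of $n$ points such that any set of links on these points with property $\phi_{min}$ requires at least $n/2$ slots when each link $\ell$ uses power $p(\ell)$.
   Context: A link $(s,r)$ is an ordered pair of points with length $d(s,r)$; for links $x=(s,r)$, $y=(s',r')$, $d_{xy}=d(s,r')$. Constants $\alpha>2$, $\beta\ge1$; noise neglected. A set $S$ of links with powers $P_\ell$ is feasible (one slot) if $\frac{P_\ell/\ell^\alpha}{\sum_{\ell'\in S\setminus\{\ell\}}P_{\ell'}/d_{\ell'\ell}^\alpha}\ge\beta$ for all $\ell\in S$; a point cannot take part in two links in the same slot. A power assignment is oblivious if the power of a link depends only on its length, via a function $p$. It is smooth if $p(x)\ge x$ for all $x$, $p$ is nondecreasing, $p(x)\le x^\alpha$, and $g(x)=\frac12\min(p(x),x^\alpha/p(x))$ is monotone increasing and $\omega(1)$. A set of links on a point set has property $\phi_{min}$ if each point is the sender or receiver of at least one link. *)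

theory Defs
  imports "HOL-Analysis.Analysis" "HOL-Library.Landau_Symbols" "HOL-Library.Extended_Real"
begin

type_synonym 'a link = "'a \<times> 'a"

abbreviation sender :: "'a link \<Rightarrow> 'a" where
  "sender \<equiv> fst"

abbreviation receiver :: "'a link \<Rightarrow> 'a" where
  "receiver \<equiv> snd"

definition link_length :: "'a::metric_space link \<Rightarrow> real" where
  "link_length x = dist (sender x) (receiver x)"

definition link_dist :: "'a::metric_space link \<Rightarrow> 'a link \<Rightarrow> real" where
  "link_dist x y = dist (sender x) (receiver y)"

definition links_on :: "'a set \<Rightarrow> 'a link set \<Rightarrow> bool" where
  "links_on V L \<longleftrightarrow> L \<subseteq> V \<times> V \<and> (\<forall>x\<in>L. sender x \<noteq> receiver x)"

definition phi_min :: "'a set \<Rightarrow> 'a link set \<Rightarrow> bool" where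
  "phi_min V L \<longleftrightarrow> (\<forall>v\<in>V. \<exists>x\<in>L. v = sender x \<or> v = receiver x)"

text \<open>The quotient is taken in the extended reals, where a positive number divided by
  \<open>0\<close> is \<open>\<infinity>\<close>; in the reals it would be \<open>0\<close>, and a link that is alone
  in its slot would fail.\<close>

definition sinr :: "real \<Rightarrow> ('a::metric_space link \<Rightarrow> real) \<Rightarrow> 'a link set \<Rightarrow> 'a link \<Rightarrow> ereal" where
  "sinr \<alpha> P S x =
     ereal (P x / link_length x powr \<alpha>) /
     ereal (\<Sum>y\<in>S - {x}. P y / link_dist y x powr \<alpha>)"

definition feasible :: "real \<Rightarrow> real \<Rightarrow> ('a::metric_space link \<Rightarrow> real) \<Rightarrow> 'a link set \<Rightarrow> bool" where
  "feasible \<alpha> \<beta> P S \<longleftrightarrow>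
     (\<forall>x\<in>S. \<forall>y\<in>S. x \<noteq> y \<longrightarrow> {sender x, receiver x} \<inter> {sender y, receiver y} = {}) \<and>
     (\<forall>x\<in>S. sinr \<alpha> P S x \<ge> ereal \<beta>)"

definition schedule ::
  "real \<Rightarrow> real \<Rightarrow> ('a::metric_space link \<Rightarrow> real) \<Rightarrow> 'a link set \<Rightarrow> nat \<Rightarrow> (nat \<Rightarrow> 'a link set) \<Rightarrow> bool" where
  "schedule \<alpha> \<beta> P L k S \<longleftrightarrow> (\<Union>t<k. S t) = L \<and> (\<forall>t<k. feasible \<alpha> \<beta> P (S t))"

definition oblivious_power :: "(real \<Rightarrow> real) \<Rightarrow> 'a::metric_space link \<Rightarrow> real" where
  "oblivious_power p x = p (link_length x)"

definition smooth_g :: "real \<Rightarrow> (real \<Rightarrow> real) \<Rightarrow> real \<Rightarrow> real" where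
  "smooth_g \<alpha> p x = 1 / 2 * min (p x) (x powr \<alpha> / p x)"

text \<open>Lengths are normalised to be at least \<open>1\<close>: for \<open>0 < x < 1\<close> and \<open>\<alpha> > 1\<close> the
  bounds \<open>x \<le> p x \<le> x powr \<alpha>\<close> contradict each other.\<close>

definition smooth :: "real \<Rightarrow> (real \<Rightarrow> real) \<Rightarrow> bool" where
  "smooth \<alpha> p \<longleftrightarrow>
     (\<forall>x\<ge>1. x \<le> p x) \<and> mono_on {1..} p \<and> (\<forall>x\<ge>1. p x \<le> x powr \<alpha>) \<and>
     mono_on {1..} (smooth_g \<alpha> p) \<and> smooth_g \<alpha> p \<in> \<omega>(\<lambda>_. 1)"

definition min_dist_one :: "'a::metric_space set \<Rightarrow> bool" where
  "min_dist_one V \<longleftrightarrow> (\<forall>u\<in>V. \<forall>v\<in>V. u \<noteq> v \<longrightarrow> 1 \<le> dist u v)"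

lemma feasible_singleton:
  assumes "sender x \<noteq> receiver x" "P x > 0"
  shows "feasible \<alpha> \<beta> P {x}"
proof -
  have "P x / link_length x powr \<alpha> > 0"
    using assms by (simp add: link_length_def)
  then show ?thesis
    by (auto simp: feasible_def sinr_def divide_ereal_def simp flip: zero_ereal_def)
qed

end

theory Submission
  imports Defs
begin

text \<open>Put the points on a line at positions \<open>X 0 = 0 < X 1 < \<dots>\<close> growing so fast that
  \<open>g\<close> exceeds \<open>X m powr \<alpha>\<close> at every length from \<open>X (m + 1) - X m\<close> on.
  Then any two links conflict. Let \<open>y\<close> be the one reaching further out, to \<open>X (m + 1)\<close>;
  all other endpoints are within distance \<open>X m\<close> of each other. If \<open>y\<close> receives at its far
  end, its power \<open>p(\<ell>) \<ge> 2 g(\<ell>)\<close>, sent from nearby, drowns the other link, whose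
  signal is at most \<open>1\<close>. If \<open>y\<close> sends from its far end, its own signal
  \<open>p(\<ell>) / \<ell> powr \<alpha> \<le> 1 / (2 g(\<ell>))\<close> is drowned by the other sender, whose
  power is at least \<open>1\<close>. So every slot holds one link, and a link covers only two points.\<close>

text \<open>With \<open>\<beta> \<ge> 1\<close> the signal at \<open>x\<close> is at least the whole
  interference \<open>I\<close>, and \<open>I\<close>, a sum of nonnegative terms, dominates the
  share of \<open>y\<close>. This reduces feasibility to an inequality between two links.\<close>

lemma feasible_interference_le_signal:
  assumes feas: "feasible \<alpha> \<beta> P S" and "\<beta> \<ge> 1" and fin: "finite S"
    and xy: "x \<in> S" "y \<in> S" "x \<noteq> y" and pos: "\<And>z. z \<in> S \<Longrightarrow> P z > 0"
  shows "P y / link_dist y x powr \<alpha> \<le> P x / link_length x powr \<alpha>"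
proof -
  define I where "I = (\<Sum>z\<in>S - {x}. P z / link_dist z x powr \<alpha>)"
  have term_le: "P y / link_dist y x powr \<alpha> \<le> I"
    unfolding I_def using fin xy pos
    by (intro member_le_sum divide_nonneg_nonneg) (auto intro: less_imp_le)
  \<comment> \<open>A nonzero distance makes the term of \<open>y\<close>, and so \<open>I\<close>,
    positive; only then is the extended quotient in \<open>sinr\<close> a real one.\<close>
  have "sender y \<noteq> receiver x"
    using feas xy by (fastforce simp: feasible_def)
  then have "P y / link_dist y x powr \<alpha> > 0"
    using pos xy by (simp add: link_dist_def)
  with term_le have "I > 0" by linarith
  have "ereal 1 \<le> ereal \<beta>"
    using \<open>\<beta> \<ge> 1\<close> by simp
  also have "\<dots> \<le> sinr \<alpha> P S x"
    using feas xy by (simp add: feasible_def)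
  also have "\<dots> = ereal (P x / link_length x powr \<alpha> / I)"
    using \<open>I > 0\<close> by (simp add: sinr_def I_def)
  finally have "1 \<le> P x / link_length x powr \<alpha> / I"
    by (simp only: ereal_less_eq)
  with \<open>I > 0\<close> have "I \<le> P x / link_length x powr \<alpha>"
    by (simp only: le_divide_eq_1_pos)
  with term_le show ?thesis by linarith
qed

lemma smooth_power_bounds:
  assumes "smooth \<alpha> p" "x \<ge> 1"
  shows "1 \<le> p x" "p x / x powr \<alpha> \<le> 1"
    "2 * smooth_g \<alpha> p x \<le> p x" "2 * smooth_g \<alpha> p x \<le> x powr \<alpha> / p x"
proof -
  have "x \<le> p x" "p x \<le> x powr \<alpha>" using assms by (simp_all add: smooth_def)
  with assms(2) show "1 \<le> p x" "p x / x powr \<alpha> \<le> 1"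
    "2 * smooth_g \<alpha> p x \<le> p x" "2 * smooth_g \<alpha> p x \<le> x powr \<alpha> / p x"
    by (simp_all add: smooth_g_def divide_le_eq_1)
qed

text \<open>The bound ranges over all \<open>y\<close> beyond the gap because a link ending at
  \<open>X (Suc m)\<close> may start at any earlier point, so the gap only bounds its length from
  below. Taking \<open>y\<close> to be the gap itself gives separation at least 1.\<close>

definition fast_growing :: "real \<Rightarrow> (real \<Rightarrow> real) \<Rightarrow> (nat \<Rightarrow> real) \<Rightarrow> bool" where
  "fast_growing \<alpha> g X \<longleftrightarrow>
     X 0 = 0 \<and> (\<forall>m. \<forall>y\<ge>X (Suc m) - X m. 1 \<le> y \<and> X m powr \<alpha> < g y)"

lemma fast_growing_exists:
  assumes "filterlim g at_top at_top"
  shows "\<exists>X. fast_growing \<alpha> g X"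
proof -
  have "\<exists>b. \<forall>y\<ge>b - a. 1 \<le> y \<and> a powr \<alpha> < g y" for a :: real
  proof -
    have "eventually (\<lambda>y. 1 \<le> y \<and> a powr \<alpha> < g y) at_top"
      using assms by (intro eventually_conj eventually_ge_at_top)
        (simp add: filterlim_at_top_dense)
    then obtain c where "\<forall>y\<ge>c. 1 \<le> y \<and> a powr \<alpha> < g y"
      unfolding eventually_at_top_linorder by blast
    then show ?thesis by (intro exI[of _ "a + c"]) simp
  qed
  \<comment> \<open>The first conjunct serves only to fix the start of the recursion at
    \<open>0\<close>.\<close>
  then have "\<exists>X. \<forall>m. (m = 0 \<longrightarrow> X m = 0) \<and>
      (\<forall>y\<ge>X (Suc m) - X m. 1 \<le> y \<and> X m powr \<alpha> < g y)"
    by (intro dependent_nat_choice) auto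
  then show ?thesis by (auto simp: fast_growing_def)
qed

lemma smooth_g_at_top:
  assumes "smooth \<alpha> p"
  shows "filterlim (smooth_g \<alpha> p) at_top at_top"
proof -
  have "eventually (\<lambda>x. smooth_g \<alpha> p x \<ge> Z) at_top" for Z
  proof -
    \<comment> \<open>The definition of \<open>\<omega>\<close> takes positive constants, hence
      \<open>max Z 1\<close>. It bounds only the norm; the sign of \<open>smooth_g\<close> comes
      from \<open>p x \<ge> 1\<close>.\<close>
    have "eventually (\<lambda>x. norm (smooth_g \<alpha> p x) \<ge> max Z 1 * norm (1::real)) at_top"
      using assms by (intro landau_omega.smallD) (auto simp: smooth_def)
    then show ?thesis
      using eventually_ge_at_top[of 1]
    proof eventually_elim
      case (elim x)
      then have "smooth_g \<alpha> p x \<ge> 0"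
        using smooth_power_bounds(1)[OF assms, of x] by (simp add: smooth_g_def)
      with elim show ?case by simp
    qed
  qed
  then show ?thesis by (simp add: filterlim_at_top)
qed

lemma fast_growing_gap:
  assumes "fast_growing \<alpha> g X" "i < j"
  shows "X i + 1 \<le> X j"
proof -
  have step: "X m + 1 \<le> X (Suc m)" for m
  proof -
    have "\<forall>y\<ge>X (Suc m) - X m. 1 \<le> y"
      using assms(1) by (simp add: fast_growing_def)
    then have "1 \<le> X (Suc m) - X m" by blast
    then show ?thesis by simp
  qed
  have "X m \<le> X (Suc m)" for m using step[of m] by simp
  then have "X (Suc i) \<le> X j"
    using assms(2) by (simp add: lift_Suc_mono_le[of X])
  with step[of i] show ?thesis by linarith
qed

lemma fast_growing_mono:
  assumes "fast_growing \<alpha> g X" "i \<le> j"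
  shows "X i \<le> X j"
  using fast_growing_gap[OF assms(1), of i j] assms(2) by (cases "i = j") auto

lemma fast_growing_dist_ge_1:
  assumes "fast_growing \<alpha> g X" "i \<noteq> j"
  shows "1 \<le> \<bar>X i - X j\<bar>"
  using fast_growing_gap[OF assms(1), of i j] fast_growing_gap[OF assms(1), of j i] assms(2)
  by linarith

text \<open>As \<open>X\<close> starts at \<open>0\<close> and increases,
  \<open>X 0, ..., X m\<close> all lie in the interval from \<open>0\<close> to
  \<open>X m\<close>.\<close>

lemma fast_growing_dist_le:
  assumes "fast_growing \<alpha> g X" "i \<le> m" "j \<le> m"
  shows "\<bar>X i - X j\<bar> \<le> X m"
proof -
  have "X 0 = 0" using assms(1) by (simp add: fast_growing_def)
  then have "0 \<le> X i" "0 \<le> X j"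
    using fast_growing_mono[OF assms(1) le0] by simp_all
  moreover have "X i \<le> X m" "X j \<le> X m"
    using fast_growing_mono[OF assms(1)] assms(2,3) by blast+
  ultimately show ?thesis by linarith
qed

lemma fast_growing_links_conflict:
  fixes f :: "nat \<Rightarrow> 'a::metric_space" and p :: "real \<Rightarrow> real"
  defines "P \<equiv> oblivious_power p"
  assumes sm: "smooth \<alpha> p" and "\<alpha> > 0" and X: "fast_growing \<alpha> (smooth_g \<alpha> p) X"
    and f: "\<And>i j. dist (f i) (f j) = \<bar>X i - X j\<bar>"
    and x: "x = (f a, f b)" "a \<noteq> b" and y: "y = (f c, f d)" "c \<noteq> d"
    and disj: "{a, b} \<inter> {c, d} = {}" and less: "max a b < max c d"
    and on_x: "P y / link_dist y x powr \<alpha> \<le> P x / link_length x powr \<alpha>"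
    and on_y: "P x / link_dist x y powr \<alpha> \<le> P y / link_length y powr \<alpha>"
  shows False
proof -
  define lx ly where "lx = link_length x" and "ly = link_length y"
  have len: "lx = \<bar>X a - X b\<bar>" "ly = \<bar>X c - X d\<bar>"
    by (simp_all add: lx_def ly_def link_length_def x y f)
  have ge1: "1 \<le> lx" "1 \<le> ly"
    unfolding len using fast_growing_dist_ge_1[OF X] x y by auto
  have P: "P x = p lx" "P y = p ly"
    by (simp_all add: P_def oblivious_power_def lx_def ly_def)
  have bounds_x: "1 \<le> p lx" "p lx / lx powr \<alpha> \<le> 1"
    and bounds_y: "1 \<le> p ly" "2 * smooth_g \<alpha> p ly \<le> p ly"
      "2 * smooth_g \<alpha> p ly \<le> ly powr \<alpha> / p ly"
    using smooth_power_bounds[OF sm] ge1 by blast+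
  \<comment> \<open>Every endpoint index other than the outermost one is at most
    \<open>m\<close>.\<close>
  obtain m where m: "max c d = Suc m"
    using less by (metis gr0_implies_Suc not_less_zero gr0I)
  have ab: "a \<le> m" "b \<le> m" using less m by auto
  have far: "ly \<ge> X (Suc m) - X m"
  proof -
    have "min c d \<le> m" using m y(2) by linarith
    then have "X (min c d) \<le> X m" by (rule fast_growing_mono[OF X])
    moreover have "ly = \<bar>X (max c d) - X (min c d)\<bar>"
      by (simp add: len max_def min_def abs_minus_commute)
    ultimately show ?thesis by (simp add: m)
  qed
  then have g: "X m powr \<alpha> < smooth_g \<alpha> p ly"
    using X by (auto simp: fast_growing_def)
  have near: "1 \<le> \<bar>X i - X j\<bar>" "\<bar>X i - X j\<bar> powr \<alpha> \<le> X m powr \<alpha>"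
    if "i \<noteq> j" "i \<le> m" "j \<le> m" for i j
    using fast_growing_dist_ge_1[OF X that(1)] fast_growing_dist_le[OF X that(2,3)] \<open>\<alpha> > 0\<close>
    by (auto intro: powr_mono2)
  show False
  \<comment> \<open>If \<open>c < d\<close>, the far end of \<open>y\<close> is its receiver and
    \<open>on_x\<close> is violated; otherwise it is its sender and \<open>on_y\<close> is
    violated.\<close>
  proof (cases "c < d")
    case True
    then have c: "c \<le> m" "c \<noteq> b" using m disj by auto
    have D: "link_dist y x = \<bar>X c - X b\<bar>" by (simp add: link_dist_def x y f)
    have "0 < link_dist y x powr \<alpha>" "link_dist y x powr \<alpha> < p ly"
      unfolding D using near[OF c(2,1) ab(2)] g bounds_y by auto
    then have "1 < p ly / link_dist y x powr \<alpha>" by simp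
    then show False
      using on_x bounds_x(2) unfolding P lx_def[symmetric] by linarith
  next
    case False
    then have d: "d \<le> m" "a \<noteq> d" using m y(2) disj by auto
    have D: "link_dist x y = \<bar>X a - X d\<bar>" by (simp add: link_dist_def x y f)
    have pos: "0 < link_dist x y powr \<alpha>"
      and lt: "link_dist x y powr \<alpha> < ly powr \<alpha> / p ly"
      unfolding D using near[OF d(2) ab(1) d(1)] g bounds_y(3) powr_ge_zero[of "X m" \<alpha>]
      by (simp, linarith)
    \<comment> \<open>The signal of \<open>y\<close> is the reciprocal of the quantity that
      smoothness bounds from below.\<close>
    have "p ly / ly powr \<alpha> = 1 / (ly powr \<alpha> / p ly)" by simp
    also have "\<dots> < 1 / link_dist x y powr \<alpha>"
      using pos lt by (intro divide_strict_left_mono mult_pos_pos) linarith+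
    also have "\<dots> \<le> p lx / link_dist x y powr \<alpha>"
      using pos bounds_x(1) by (intro divide_right_mono) auto
    finally show False
      using on_y unfolding P ly_def[symmetric] by linarith
  qed
qed

lemma phi_min_card_le:
  assumes "phi_min V L" "finite L"
  shows "card V \<le> 2 * card L"
proof -
  have "V \<subseteq> fst ` L \<union> snd ` L"
    using assms(1) by (auto simp: phi_min_def)
  then have "card V \<le> card (fst ` L \<union> snd ` L)"
    using assms(2) by (intro card_mono) auto
  also have "\<dots> \<le> card (fst ` L) + card (snd ` L)" by (rule card_Un_le)
  also have "\<dots> \<le> 2 * card L"
    using card_image_le[OF assms(2), of fst] card_image_le[OF assms(2), of snd] by simp
  finally show ?thesis .
qed

theorem theorem6:
  fixes \<alpha> \<beta> :: real and p :: "real \<Rightarrow> real" and n :: nat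
  assumes "\<alpha> > 2" and "\<beta> \<ge> 1" and "smooth \<alpha> p"
  shows "\<exists>V :: 'a::euclidean_space set. finite V \<and> card V = n \<and> min_dist_one V \<and>
    (\<forall>L. links_on V L \<and> phi_min V L \<longrightarrow>
      (\<forall>k S. schedule \<alpha> \<beta> (oblivious_power p) L k S \<longrightarrow> real k \<ge> real n / 2))"
proof -
  have "\<alpha> > 0" using assms(1) by simp
  obtain X where X: "fast_growing \<alpha> (smooth_g \<alpha> p) X"
    using fast_growing_exists[OF smooth_g_at_top[OF assms(3)]] by blast
  \<comment> \<open>A unit vector carries the positions \<open>X i\<close> isometrically into a
    space of any dimension.\<close>
  obtain e :: 'a where "e \<in> Basis" using nonempty_Basis by blast
  define f where "f i = X i *\<^sub>R e" for i
  have f: "dist (f i) (f j) = \<bar>X i - X j\<bar>" for i j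
    using \<open>e \<in> Basis\<close> by (simp add: f_def dist_norm flip: scaleR_diff_left)
  have f_ge1: "1 \<le> dist (f i) (f j)" if "i \<noteq> j" for i j
    using fast_growing_dist_ge_1[OF X that] by (simp add: f)
  have "inj f"
    by (rule injI) (metis f_ge1 dist_self not_one_le_zero)
  define V where "V = f ` {..<n}"
  have V: "finite V" "card V = n"
    by (simp_all add: V_def card_image[OF inj_on_subset[OF \<open>inj f\<close>]])
  have "min_dist_one V"
    by (auto simp: min_dist_one_def V_def intro!: f_ge1)
  moreover have "real k \<ge> real n / 2"
    if L: "links_on V L" "phi_min V L" and sched: "schedule \<alpha> \<beta> (oblivious_power p) L k S"
    for L k S
  proof -
    have "L \<subseteq> V \<times> V" using L by (simp add: links_on_def)
    then have "finite L" using V(1) finite_subset by blast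
    have ends: "\<exists>a b. z = (f a, f b) \<and> a \<noteq> b" if "z \<in> L" for z
      using that L by (fastforce simp: links_on_def V_def)
    have "card (S t) \<le> 1" if "t < k" for t
    proof -
      have sub: "S t \<subseteq> L" and feas: "feasible \<alpha> \<beta> (oblivious_power p) (S t)"
        using sched \<open>t < k\<close> by (auto simp: schedule_def)
      have fin: "finite (S t)" using sub \<open>finite L\<close> finite_subset by blast
      have pos: "oblivious_power p z > 0" if z: "z \<in> S t" for z
      proof -
        obtain a b where "z = (f a, f b)" "a \<noteq> b" using ends sub z by blast
        then have "1 \<le> link_length z" by (simp add: link_length_def f_ge1)
        from smooth_power_bounds(1)[OF assms(3) this] show ?thesis
          by (simp add: oblivious_power_def)
      qed
      have "x = y" if "x \<in> S t" "y \<in> S t" for x y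
      proof (rule ccontr)
        assume "x \<noteq> y"
        note le = feasible_interference_le_signal[OF feas assms(2) fin _ _ _ pos]
        note le_xy = le[OF that \<open>x \<noteq> y\<close>] le[OF that(2,1) \<open>x \<noteq> y\<close>[symmetric]]
        obtain a b where x: "x = (f a, f b)" "a \<noteq> b" using ends sub \<open>x \<in> S t\<close> by blast
        obtain c d where y: "y = (f c, f d)" "c \<noteq> d" using ends sub \<open>y \<in> S t\<close> by blast
        have "{sender x, receiver x} \<inter> {sender y, receiver y} = {}"
          using feas that \<open>x \<noteq> y\<close> by (simp add: feasible_def)
        then have disj: "{a, b} \<inter> {c, d} = {}" "{c, d} \<inter> {a, b} = {}"
          by (auto simp: x y)
        \<comment> \<open>Without a common endpoint, one link reaches strictly further out; the
          conflict lemma covers both orders.\<close>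
        then have "max a b \<noteq> max c d" by (auto simp: max_def split: if_splits)
        then have "max a b < max c d \<or> max c d < max a b" by linarith
        moreover have "\<not> max a b < max c d"
          using fast_growing_links_conflict[OF assms(3) \<open>\<alpha> > 0\<close> X f x y disj(1) _ le_xy] by blast
        moreover have "\<not> max c d < max a b"
          using fast_growing_links_conflict[OF assms(3) \<open>\<alpha> > 0\<close> X f y x disj(2) _ le_xy(2,1)] by blast
        ultimately show False by blast
      qed
      then show ?thesis using fin by (simp add: card_le_Suc0_iff_eq)
    qed
    \<comment> \<open>One link per slot gives \<open>card L \<le> k\<close>, while covering
      \<open>n\<close> points takes at least \<open>n / 2\<close> links.\<close>
    then have "(\<Sum>t<k. card (S t)) \<le> (\<Sum>t<k. 1)" by (intro sum_mono) simp
    moreover have "card L \<le> (\<Sum>t<k. card (S t))"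
      using sched card_UN_le[of "{..<k}" S] by (simp add: schedule_def)
    ultimately have "n \<le> 2 * k"
      using phi_min_card_le[OF L(2) \<open>finite L\<close>] V(2) by simp
    then show ?thesis by simp
  qed
  ultimately show ?thesis using V by blast
qed

end
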